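(* Suppose $\mathfrak{F} = (F; +, \cdot, \le)$ is an ordered field. If $\mathfrak{F}$ is convexly orderable, then every positive element of $F$ has an $n^{\text{th}}$ root in $F$ for all $n \ge 1$.
   Context: A structure $\mathfrak{M}$ is convexly orderable if there is a linear order $\unlhd$ on $M$ (not necessarily definable) such that for every formula $\varphi(x;\bar y)$ ($x$ a single variable) there is $k<\omega$ such that for all $\bar b\in M^{|\bar y|}$, the set $\varphi(\mathfrak{M};\bar b)=\{a\in M:\mathfrak{M}\models\varphi(a;\bar b)\}$ is a union of at most $k$ $\unlhd$-convex subsets of $M$. Here $\unlhd$ need not be the field order $\le$. *)

theory Defs
  imports Main
begin

datatype 'f trm = Var nat | App 'f "'f trm list"

datatype ('f, 'r) form =
    Eq "'f trm" "'f trm"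
  | Rel 'r "'f trm list"
  | Neg "('f, 'r) form"
  | Conj "('f, 'r) form" "('f, 'r) form"
  | Ex nat "('f, 'r) form"

text \<open>The symbols of a language are listed together with their arities.\<close>

record ('f, 'r) language =
  fun_syms :: "('f \<times> nat) set"
  rel_syms :: "('r \<times> nat) set"

text \<open>The universe of a structure is the whole type \<open>'a\<close>. Interpretations are only
  relevant on argument lists of the right length, since ill-formed formulas are excluded
  below.\<close>

record ('f, 'r, 'a) struct = "('f, 'r) language" +
  fun_int :: "'f \<Rightarrow> 'a list \<Rightarrow> 'a"
  rel_int :: "'r \<Rightarrow> 'a list \<Rightarrow> bool"

fun wf_trm :: "('f, 'r, 'z) language_scheme \<Rightarrow> 'f trm \<Rightarrow> bool" where
  "wf_trm L (Var v) \<longleftrightarrow> True"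
| "wf_trm L (App f ts) \<longleftrightarrow> (f, length ts) \<in> fun_syms L \<and> (\<forall>t\<in>set ts. wf_trm L t)"

primrec wf_form :: "('f, 'r, 'z) language_scheme \<Rightarrow> ('f, 'r) form \<Rightarrow> bool" where
  "wf_form L (Eq s t) \<longleftrightarrow> wf_trm L s \<and> wf_trm L t"
| "wf_form L (Rel R ts) \<longleftrightarrow> (R, length ts) \<in> rel_syms L \<and> (\<forall>t\<in>set ts. wf_trm L t)"
| "wf_form L (Neg \<phi>) \<longleftrightarrow> wf_form L \<phi>"
| "wf_form L (Conj \<phi> \<psi>) \<longleftrightarrow> wf_form L \<phi> \<and> wf_form L \<psi>"
| "wf_form L (Ex v \<phi>) \<longleftrightarrow> wf_form L \<phi>"

primrec trm_val :: "('f, 'r, 'a) struct \<Rightarrow> (nat \<Rightarrow> 'a) \<Rightarrow> 'f trm \<Rightarrow> 'a" where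
  "trm_val M e (Var v) = e v"
| "trm_val M e (App f ts) = fun_int M f (map (trm_val M e) ts)"

primrec sat :: "('f, 'r, 'a) struct \<Rightarrow> (nat \<Rightarrow> 'a) \<Rightarrow> ('f, 'r) form \<Rightarrow> bool" where
  "sat M e (Eq s t) \<longleftrightarrow> trm_val M e s = trm_val M e t"
| "sat M e (Rel R ts) \<longleftrightarrow> rel_int M R (map (trm_val M e) ts)"
| "sat M e (Neg \<phi>) \<longleftrightarrow> \<not> sat M e \<phi>"
| "sat M e (Conj \<phi> \<psi>) \<longleftrightarrow> sat M e \<phi> \<and> sat M e \<psi>"
| "sat M e (Ex v \<phi>) \<longleftrightarrow> (\<exists>a. sat M (e(v := a)) \<phi>)"

text \<open>The set \<open>\<phi>(M; b)\<close>. The variable \<open>x\<close> is the distinguished one; all other variables of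
  \<open>\<phi>\<close> are parameter variables, and their values are given by the assignment \<open>b\<close> (whose
  value at \<open>x\<close> is irrelevant).\<close>

definition def_set :: "('f, 'r, 'a) struct \<Rightarrow> ('f, 'r) form \<Rightarrow> nat \<Rightarrow> (nat \<Rightarrow> 'a) \<Rightarrow> 'a set" where
  "def_set M \<phi> x b = {a. sat M (b(x := a)) \<phi>}"

definition order_convex :: "('a \<times> 'a) set \<Rightarrow> 'a set \<Rightarrow> bool" where
  "order_convex r C \<longleftrightarrow> (\<forall>a\<in>C. \<forall>b\<in>C. \<forall>c. (a, c) \<in> r \<and> (c, b) \<in> r \<longrightarrow> c \<in> C)"

definition union_of_convex :: "('a \<times> 'a) set \<Rightarrow> nat \<Rightarrow> 'a set \<Rightarrow> bool" where
  "union_of_convex r k S \<longleftrightarrow>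
     (\<exists>\<C>. finite \<C> \<and> card \<C> \<le> k \<and> (\<forall>C\<in>\<C>. order_convex r C) \<and> S = \<Union>\<C>)"

text \<open>The linear order \<open>r\<close> is reflexive and need not be definable in \<open>M\<close>.\<close>

definition convexly_orderable :: "('f, 'r, 'a) struct \<Rightarrow> bool" where
  "convexly_orderable M \<longleftrightarrow>
     (\<exists>r. linear_order r \<and>
       (\<forall>\<phi> x. wf_form M \<phi> \<longrightarrow> (\<exists>k. \<forall>b. union_of_convex r k (def_set M \<phi> x b))))"

datatype of_fun = Plus | Times
datatype of_rel = Leq

definition ordered_field_struct ::
    "(of_fun, of_rel, 'a::linordered_field) struct" where
  "ordered_field_struct =
     \<lparr>fun_syms = {(Plus, 2), (Times, 2)},
      rel_syms = {(Leq, 2)},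
      fun_int = (\<lambda>f as. case f of Plus \<Rightarrow> as ! 0 + as ! 1 | Times \<Rightarrow> as ! 0 * as ! 1),
      rel_int = (\<lambda>R as. case R of Leq \<Rightarrow> as ! 0 \<le> as ! 1)\<rparr>"

end

theory Submission
  imports Defs
begin

text \<open>If \<open>a > 1\<close> is not an \<open>n\<close>-th power, then \<open>a\<close>, \<open>a^n\<close>, \<open>a^(n^2)\<close>, \dots, \<open>a^(n^(K-1))\<close> lie in
  distinct cosets of the group of \<open>N\<close>-th powers, where \<open>N = n^K\<close>. Each of the infinitely many
  disjoint intervals \<open>[a^(2Nj), a^(2Nj+N)]\<close> meets all of these \<open>K\<close> cosets. A convex ordering
  cannot accommodate such a grid once \<open>K\<close> exceeds the number of convex pieces that is allowed
  for intervals: every interval then has two of its grid points in one convex piece, and for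
  some two intervals these pairs are placed in the same way, so that they would have to
  interleave.\<close>

lemma linear_order_cases:
  assumes "linear_order r"
  obtains "(a, b) \<in> r" | "(b, a) \<in> r"
  using assms by (cases "a = b") (auto simp: order_on_defs refl_on_def total_on_def)

text \<open>Two pigeonhole arguments. Inside each column \<open>X j\<close> two grid points share a
  convex piece, as there are more than \<open>k\<close> rows. The placement of this pair follows one
  of finitely many patterns, so two columns repeat a pattern.\<close>

lemma no_convex_grid:
  fixes p :: "'i \<Rightarrow> nat \<Rightarrow> 'a"
  assumes lin: "linear_order r"
    and fin: "finite I" and card: "card I > k"
    and X: "\<And>j. union_of_convex r k (X j)"
    and Y: "\<And>i. i \<in> I \<Longrightarrow> union_of_convex r l (Y i)"
    and pX: "\<And>i j j'. i \<in> I \<Longrightarrow> p i j \<in> X j' \<longleftrightarrow> j = j'"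
    and pY: "\<And>i i' j. i \<in> I \<Longrightarrow> i' \<in> I \<Longrightarrow> p i j \<in> Y i' \<longleftrightarrow> i = i'"
  shows False
proof -
  obtain D where D: "\<And>i. i \<in> I \<Longrightarrow> finite (D i)" "\<And>i. i \<in> I \<Longrightarrow> Y i = \<Union>(D i)"
    "\<And>i C. i \<in> I \<Longrightarrow> C \<in> D i \<Longrightarrow> order_convex r C"
    using Y unfolding union_of_convex_def by metis
  let ?T = "I \<times> I \<times> (\<Union>i\<in>I. D i)"
  \<comment> \<open>A pattern records the two rows in order and a piece \<open>C\<close> of row
    \<open>i\<close>. The piece \<open>B\<close> of the column is only asserted to exist: it varies
    with \<open>j\<close>, while the set of patterns has to be independent of
    \<open>j\<close>.\<close>
  define good where "good j = (\<lambda>(i, i', C). i \<noteq> i' \<and> (p i j, p i' j) \<in> r \<and> p i j \<in> C \<and> C \<in> D i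
    \<and> (\<exists>B \<subseteq> X j. order_convex r B \<and> p i j \<in> B \<and> p i' j \<in> B))" for j
  have "\<exists>t\<in>?T. good j t" for j
  proof -
    obtain \<C> where \<C>: "finite \<C>" "card \<C> \<le> k" "\<And>C. C \<in> \<C> \<Longrightarrow> order_convex r C" "X j = \<Union>\<C>"
      using X[of j] unfolding union_of_convex_def by metis
    have "\<forall>i\<in>I. \<exists>C\<in>\<C>. p i j \<in> C"
      using pX[of _ j j] \<C>(4) by auto
    then obtain f where f: "\<And>i. i \<in> I \<Longrightarrow> f i \<in> \<C> \<and> p i j \<in> f i"
      by metis
    have "\<not> inj_on f I"
    proof
      assume "inj_on f I"
      then have "card I \<le> card \<C>"
        using f \<C>(1) by (intro card_inj_on_le) auto
      then show False using card \<C>(2) by simp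
    qed
    then obtain i i' where ii: "i \<in> I" "i' \<in> I" "i \<noteq> i'" "f i = f i'"
      by (auto simp: inj_on_def)
    obtain u v where uv: "u \<in> I" "v \<in> I" "u \<noteq> v" "f u = f v" "(p u j, p v j) \<in> r"
      using linear_order_cases[OF lin, of "p i j" "p i' j"] ii by metis
    have "p u j \<in> Y u" using pY uv by simp
    then obtain C where C: "C \<in> D u" "p u j \<in> C" using D(2) uv by auto
    have "f u \<subseteq> X j" "order_convex r (f u)" "p u j \<in> f u" "p v j \<in> f u"
      using f[OF uv(1)] f[OF uv(2)] uv(4) \<C> by auto
    then have "good j (u, v, C)"
      unfolding good_def using uv C by auto
    then show ?thesis using uv C by blast
  qed
  then obtain t where t: "\<And>j. t j \<in> ?T" "\<And>j. good j (t j)" by metis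
  have "finite ?T" using fin D(1) by auto
  then have "\<not> inj t"
    using t(1) by (metis finite_imageD finite_subset image_subsetI infinite_UNIV_nat)
  then obtain j1 j2 where "j1 \<noteq> j2" "t j1 = t j2" by (auto simp: inj_on_def)
  moreover obtain i i' C where "t j1 = (i, i', C)" by (cases "t j1")
  ultimately have *: "i \<in> I" "i' \<in> I" "good j1 (i, i', C)" "good j2 (i, i', C)"
    using t(1)[of j1] t(2)[of j1] t(2)[of j2] by auto
  obtain j j' where j: "j \<noteq> j'" "good j (i, i', C)" "good j' (i, i', C)" "(p i j, p i j') \<in> r"
    using linear_order_cases[OF lin, of "p i j1" "p i j2"] * \<open>j1 \<noteq> j2\<close> by metis
  obtain B where B: "B \<subseteq> X j" "order_convex r B" "p i j \<in> B" "p i' j \<in> B"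
    using j(2) unfolding good_def by auto
  have C: "i \<noteq> i'" "C \<in> D i" "p i j \<in> C" "p i j' \<in> C"
    using j(2,3) unfolding good_def by auto
  \<comment> \<open>Both \<open>p i' j\<close> and \<open>p i j'\<close> lie above
    \<open>p i j\<close>. If \<open>p i' j\<close> is the lower of the two, it is caught between two
    points of \<open>C\<close>, hence in row \<open>i\<close>; otherwise \<open>p i j'\<close> is
    caught between two points of \<open>B\<close>, hence in column \<open>j\<close>.\<close>
  show False
  proof (rule linear_order_cases[OF lin, of "p i' j" "p i j'"])
    assume "(p i' j, p i j') \<in> r"
    moreover have "(p i j, p i' j) \<in> r" using j(2) unfolding good_def by auto
    ultimately have "p i' j \<in> C"
      using D(3)[OF *(1) C(2)] C unfolding order_convex_def by blast
    then have "p i' j \<in> Y i" using D(2) C * by auto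
    then show False using pY C * by auto
  next
    assume "(p i j', p i' j) \<in> r"
    then have "p i j' \<in> B" using B j(4) unfolding order_convex_def by blast
    then show False using B(1) pX[OF *(1), of j' j] j(1) by auto
  qed
qed

text \<open>As \<open>s\<close> is below both \<open>K\<close> and \<open>t\<close>, both sides are
  \<open>n ^ s\<close>-th powers of positive elements. Cancelling that exponent equates
  \<open>a\<close> times an \<open>n\<close>-th power with an \<open>n\<close>-th power.\<close>

lemma root_of_power_eq:
  fixes a :: "'a::linordered_field"
  assumes "a > 0" "u > 0" "v > 0" "n > 0" "s < t" "s < K"
    and eq: "u ^ (n ^ K) * a ^ (n ^ s) = v ^ (n ^ K) * a ^ (n ^ t)"
  shows "\<exists>b. b ^ n = a"
proof -
  obtain d where d: "K = s + Suc d" using \<open>s < K\<close> less_imp_Suc_add by fastforce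
  obtain e where e: "t = s + Suc e" using \<open>s < t\<close> less_imp_Suc_add by fastforce
  let ?U = "u ^ (n ^ d)" and ?V = "v ^ (n ^ d)" and ?A = "a ^ (n ^ e)"
  have "(?U ^ n * a) ^ (n ^ s) = (?V ^ n * ?A ^ n) ^ (n ^ s)"
    using eq by (simp add: d e power_mult_distrib power_add ac_simps flip: power_mult)
  then have "?U ^ n * a = ?V ^ n * ?A ^ n"
    by (rule power_eq_imp_eq_base) (use assms in auto)
  then have "(?V * ?A / ?U) ^ n = a"
    using assms by (simp add: power_mult_distrib power_divide field_simps)
  then show ?thesis by blast
qed

definition interval_form :: "(of_fun, of_rel) form" where
  "interval_form = Conj (Rel Leq [Var 1, Var 0]) (Rel Leq [Var 0, Var 2])"

lemma wf_interval_form: "wf_form ordered_field_struct interval_form"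
  by (simp add: interval_form_def ordered_field_struct_def)

lemma def_set_interval_form: "def_set ordered_field_struct interval_form 0 b = {b 1..b 2}"
  by (auto simp: def_set_def interval_form_def ordered_field_struct_def)

text \<open>The language has no constant 1, so the recursion starts from the coset representative
  \<open>Var 1\<close> instead of an empty product.\<close>

fun power_trm :: "nat \<Rightarrow> of_fun trm" where
  "power_trm 0 = Var 1"
| "power_trm (Suc m) = App Times [Var 2, power_trm m]"

definition power_coset_form :: "nat \<Rightarrow> (of_fun, of_rel) form" where
  "power_coset_form m = Ex 2 (Eq (Var 0) (power_trm m))"

lemma wf_power_coset_form: "wf_form ordered_field_struct (power_coset_form m)"
proof -
  have "wf_trm ordered_field_struct (power_trm m)"
    by (induction m) (simp_all add: ordered_field_struct_def)
  then show ?thesis by (simp add: power_coset_form_def)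
qed

lemma def_set_power_coset_form:
  "def_set ordered_field_struct (power_coset_form m) 0 b = {x. \<exists>y. x = y ^ m * b 1}"
proof -
  have "trm_val ordered_field_struct e (power_trm m) = e 2 ^ m * e 1" for e :: "nat \<Rightarrow> 'a"
    by (induction m) (simp_all add: ordered_field_struct_def mult.assoc)
  then show ?thesis by (simp add: def_set_def power_coset_form_def)
qed

lemma convexly_orderable_root_gt_1:
  fixes a :: "'a::linordered_field"
  assumes co: "convexly_orderable (ordered_field_struct :: (of_fun, of_rel, 'a) struct)"
    and a: "a > 1" and n: "n > 0"
  shows "\<exists>b. b ^ n = a"
proof (rule ccontr)
  assume no_root: "\<nexists>b. b ^ n = a"
  let ?M = "ordered_field_struct :: (of_fun, of_rel, 'a) struct"
  obtain r where r: "linear_order r"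
    and conv: "\<And>\<phi> x. wf_form ?M \<phi> \<Longrightarrow> \<exists>k. \<forall>b. union_of_convex r k (def_set ?M \<phi> x b)"
    using co unfolding convexly_orderable_def by blast
  obtain k where k: "\<And>b. union_of_convex r k (def_set ?M interval_form 0 b)"
    using conv[OF wf_interval_form] by blast
  \<comment> \<open>The rows are 0, ..., \<open>k\<close>, one more than the number of pieces of an
    interval; the exponent \<open>Suc k\<close> exceeds each row index, as the cancellation
    requires.\<close>
  define N where "N = n ^ Suc k"
  obtain l where l: "\<And>b. union_of_convex r l (def_set ?M (power_coset_form N) 0 b)"
    using conv[OF wf_power_coset_form] by blast
  \<comment> \<open>The factor \<open>a ^ (2 * N * j)\<close> is an \<open>N\<close>-th power, so
    moving to another interval does not change the coset.\<close>
  define p where "p s j = a ^ (n ^ s + 2 * N * j)" for s j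
  define X where "X j = {a ^ (2 * N * j)..a ^ (2 * N * j + N)}" for j
  define Y where "Y s = {x. \<exists>y. x = y ^ N * a ^ (n ^ s)}" for s
  have N: "N > 0" using n by (simp add: N_def)
  show False
  proof (rule no_convex_grid[OF r, of "{..k}" k X l Y p])
    fix j
    show "union_of_convex r k (X j)"
      using k[of "(\<lambda>_. 0)(1 := a ^ (2 * N * j), 2 := a ^ (2 * N * j + N))"]
      by (simp add: def_set_interval_form X_def)
  next
    fix s
    show "union_of_convex r l (Y s)"
      using l[of "\<lambda>_. a ^ (n ^ s)"] by (simp add: def_set_power_coset_form Y_def)
  next
    fix s j j' assume "s \<in> {..k}"
    then have s: "n ^ s \<le> N" using n unfolding N_def by (intro power_increasing) auto
    \<comment> \<open>As \<open>a > 1\<close>, membership in an interval is a comparison of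
      exponents. The factor 2 leaves gaps between the intervals, so that
      \<open>n ^ s \<le> N\<close> suffices.\<close>
    have "2 * N * j' \<le> n ^ s + 2 * N * j \<and> n ^ s + 2 * N * j \<le> 2 * N * j' + N \<longleftrightarrow> j = j'"
    proof (cases j j' rule: linorder_cases)
      case less
      then have "2 * N * Suc j \<le> 2 * N * j'" by (intro mult_le_mono2) simp
      then show ?thesis using s N less by simp
    next
      case greater
      then have "2 * N * Suc j' \<le> 2 * N * j" by (intro mult_le_mono2) simp
      then show ?thesis using s N greater by simp
    qed (use s in simp)
    then show "p s j \<in> X j' \<longleftrightarrow> j = j'"
      using a by (simp add: p_def X_def del: power_Suc)
  next
    fix s t j assume st: "s \<in> {..k}" "t \<in> {..k}"
    have p: "p s j = (a ^ (2 * j)) ^ N * a ^ (n ^ s)"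
      by (simp add: p_def power_add ac_simps flip: power_mult)
    show "p s j \<in> Y t \<longleftrightarrow> s = t"
    proof
      assume "p s j \<in> Y t"
      then obtain y where y: "p s j = y ^ N * a ^ (n ^ t)" by (auto simp: Y_def)
      have "p s j > 0" using a by (simp add: p_def)
      then have "y ^ N > 0" using y a by (simp add: zero_less_mult_iff)
      \<comment> \<open>For even \<open>N\<close> the witness \<open>y\<close> may be negative; its
        absolute value has the same \<open>N\<close>-th power and is positive, as the cancellation
        requires.\<close>
      then have "y \<noteq> 0" "\<bar>y\<bar> ^ N = y ^ N"
        using N by (auto simp flip: power_abs simp: zero_power)
      then have eq: "(a ^ (2 * j)) ^ N * a ^ (n ^ s) = \<bar>y\<bar> ^ N * a ^ (n ^ t)" and "\<bar>y\<bar> > 0"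
        using p y by auto
      show "s = t"
      proof (cases s t rule: linorder_cases)
        case less
        then show ?thesis
          using root_of_power_eq[of a "a ^ (2 * j)" "\<bar>y\<bar>" n s t "Suc k"] eq \<open>\<bar>y\<bar> > 0\<close> a n st no_root
          unfolding N_def by auto
      next
        case greater
        then show ?thesis
          using root_of_power_eq[of a "\<bar>y\<bar>" "a ^ (2 * j)" n t s "Suc k"] eq \<open>\<bar>y\<bar> > 0\<close> a n st no_root
          unfolding N_def by auto
      qed
    qed (use p in \<open>auto simp: Y_def\<close>)
  qed auto
qed

theorem proposition3p6:
  assumes "convexly_orderable (ordered_field_struct :: (of_fun, of_rel, 'a::linordered_field) struct)"
  shows "\<forall>n\<ge>1. \<forall>a::'a. a > 0 \<longrightarrow> (\<exists>b. b ^ n = a)"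
proof (intro allI impI)
  fix n :: nat and a :: 'a
  assume n: "n \<ge> 1" and a: "a > 0"
  \<comment> \<open>An element below 1 is treated through its inverse.\<close>
  consider "a > 1" | "a = 1" | "inverse a > 1"
    using a one_less_inverse by (cases a "1 :: 'a" rule: linorder_cases) auto
  then show "\<exists>b. b ^ n = a"
  proof cases
    case 1
    then show ?thesis using convexly_orderable_root_gt_1[OF assms] n by simp
  next
    case 2
    then show ?thesis by (intro exI[of _ 1]) simp
  next
    case 3
    then obtain b where "b ^ n = inverse a"
      using convexly_orderable_root_gt_1[OF assms] n by fastforce
    then have "inverse b ^ n = a" by (simp add: power_inverse)
    then show ?thesis by blast
  qed
qed

end
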